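(* Let $G = G(m,n,\vec{a},\vec{b})$ be a down-left graph. Then the graph $G$ is well-covered, $C_5$-free, and vertex decomposable.
   Context: All graphs are finite and simple. For positive integers $m,n$, $G(m,n)$ is the graph with vertex set $\{x_{i,j} \mid 1\le i\le m,\ 1\le j\le n\}$ and edge set $\{\{x_{i,j},x_{k,\ell}\} \mid i<k,\ j>\ell\}$. Down-left graphs: let $\vec a=(a_1,\dots,a_m)$ and $\vec b=(b_1,\dots,b_m)$ be vectors in $\mathbb{Z}_{\ge 0}^m$ such that $0=a_1\le a_2\le\cdots\le a_m<n$, $1<b_1\le b_2\le\cdots\le b_{m-1}\le b_m=n+1$, and $a_i<b_i$ for all $2\le i\le m-1$. Let $W=\{x_{i,j}\mid 2\le i\le m,\ 1\le j\le a_i\}$ and $Z=\{x_{i,j}\mid 1\le i\le m-1,\ b_i\le j\le n\}$. The down-left graph $G(m,n,\vec a,\vec b)$ is the induced subgraph of $G(m,n)$ on $V(G(m,n))\setminus(W\cup Z)$ (equivalently, on the vertices $x_{i,j}$ with $a_i<j<b_i$). A graph is well-covered if all its minimal vertex covers (equivalently, all its maximal independent sets) have the same cardinality. A graph is $C_5$-free if it has no induced subgraph isomorphic to the $5$-cycle. For a vertex $x$, $N[x]$ denotes the closed neighborhood of $x$ (i.e. $x$ together with all vertices adjacent to $x$); $G\setminus x$ and $G\setminus N[x]$ denote the graphs obtained by deleting $x$, respectively all vertices of $N[x]$, together with all incident edges. A graph $G$ is vertex decomposable (recursive definition) if $G$ is well-covered and either $G$ consists only of isolated vertices (i.e. has no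 edges), or there is a vertex $x$ of $G$ such that $G\setminus x$ and $G\setminus N[x]$ are both vertex decomposable. *)

theory Defs
  imports Main
begin

datatype 'a ugraph = UGraph (verts: "'a set") (edges: "'a set set")

definition finite_simple :: "'a ugraph \<Rightarrow> bool" where
  "finite_simple G \<longleftrightarrow> finite (verts G) \<and> (\<forall>e\<in>edges G. e \<subseteq> verts G \<and> card e = 2)"

definition induced :: "'a ugraph \<Rightarrow> 'a set \<Rightarrow> 'a ugraph" where
  "induced G S = UGraph (verts G \<inter> S) {e \<in> edges G. e \<subseteq> S}"

definition del_verts :: "'a ugraph \<Rightarrow> 'a set \<Rightarrow> 'a ugraph" where
  "del_verts G S = induced G (verts G - S)"

definition closed_nbhd :: "'a ugraph \<Rightarrow> 'a \<Rightarrow> 'a set" where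
  "closed_nbhd G x = insert x {y \<in> verts G. {x, y} \<in> edges G}"

definition isomorphic :: "'a ugraph \<Rightarrow> 'b ugraph \<Rightarrow> bool" where
  "isomorphic G H \<longleftrightarrow>
     (\<exists>f. bij_betw f (verts G) (verts H) \<and>
          (\<forall>u\<in>verts G. \<forall>v\<in>verts G. {u, v} \<in> edges G \<longleftrightarrow> {f u, f v} \<in> edges H))"

definition cycle5 :: "nat ugraph" where
  "cycle5 = UGraph {0..<5} {{i, (i + 1) mod 5} | i. i < 5}"

definition C5_free :: "'a ugraph \<Rightarrow> bool" where
  "C5_free G \<longleftrightarrow> \<not> (\<exists>S\<subseteq>verts G. isomorphic (induced G S) cycle5)"

definition vertex_cover :: "'a ugraph \<Rightarrow> 'a set \<Rightarrow> bool" where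
  "vertex_cover G C \<longleftrightarrow> C \<subseteq> verts G \<and> (\<forall>e\<in>edges G. e \<inter> C \<noteq> {})"

definition minimal_vertex_cover :: "'a ugraph \<Rightarrow> 'a set \<Rightarrow> bool" where
  "minimal_vertex_cover G C \<longleftrightarrow> vertex_cover G C \<and> (\<forall>D. D \<subset> C \<longrightarrow> \<not> vertex_cover G D)"

definition well_covered :: "'a ugraph \<Rightarrow> bool" where
  "well_covered G \<longleftrightarrow>
     (\<forall>C D. minimal_vertex_cover G C \<and> minimal_vertex_cover G D \<longrightarrow> card C = card D)"

inductive vertex_decomposable :: "'a ugraph \<Rightarrow> bool" where
  isolated: "vertex_decomposable G"
    if "well_covered G" and "edges G = {}"
| shedding: "vertex_decomposable G"
    if "well_covered G" and "x \<in> verts G"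
      and "vertex_decomposable (del_verts G {x})"
      and "vertex_decomposable (del_verts G (closed_nbhd G x))"

text \<open>The vertex \<open>x\<^sub>i\<^sub>,\<^sub>j\<close> is represented by the pair \<open>(i, j)\<close>.\<close>

definition grid_graph :: "nat \<Rightarrow> nat \<Rightarrow> (nat \<times> nat) ugraph" where
  "grid_graph m n =
     (let V = {1..m} \<times> {1..n}
      in UGraph V {{(i, j), (k, l)} | i j k l. (i, j) \<in> V \<and> (k, l) \<in> V \<and> i < k \<and> j > l})"

text \<open>
  A vector in \<open>\<int>\<^sub>\<ge>\<^sub>0\<^sup>m\<close> is a function on \<open>nat\<close> of which only the values at \<open>1, \<dots>, m\<close> are used.
  In \<open>del_Z\<close> and in the last condition below, \<open>i < m\<close> stands for \<open>i \<le> m - 1\<close>.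
\<close>

definition down_left_vectors :: "nat \<Rightarrow> nat \<Rightarrow> (nat \<Rightarrow> nat) \<Rightarrow> (nat \<Rightarrow> nat) \<Rightarrow> bool" where
  "down_left_vectors m n a b \<longleftrightarrow>
     a 1 = 0 \<and> mono_on {1..m} a \<and> a m < n \<and>
     1 < b 1 \<and> mono_on {1..m} b \<and> b m = n + 1 \<and>
     (\<forall>i. 2 \<le> i \<and> i < m \<longrightarrow> a i < b i)"

definition del_W :: "nat \<Rightarrow> (nat \<Rightarrow> nat) \<Rightarrow> (nat \<times> nat) set" where
  "del_W m a = {(i, j). 2 \<le> i \<and> i \<le> m \<and> 1 \<le> j \<and> j \<le> a i}"

definition del_Z :: "nat \<Rightarrow> nat \<Rightarrow> (nat \<Rightarrow> nat) \<Rightarrow> (nat \<times> nat) set" where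
  "del_Z m n b = {(i, j). 1 \<le> i \<and> i < m \<and> b i \<le> j \<and> j \<le> n}"

definition down_left_graph ::
  "nat \<Rightarrow> nat \<Rightarrow> (nat \<Rightarrow> nat) \<Rightarrow> (nat \<Rightarrow> nat) \<Rightarrow> (nat \<times> nat) ugraph" where
  "down_left_graph m n a b =
     induced (grid_graph m n) (verts (grid_graph m n) - (del_W m a \<union> del_Z m n b))"

lemma finite_simple_down_left_graph: "finite_simple (down_left_graph m n a b)"
proof -
  have "card {(i, j), (k, l)} = 2" if "i < k" for i j k l :: nat
    using that by simp
  then show ?thesis
    by (auto simp: finite_simple_def down_left_graph_def induced_def grid_graph_def Let_def)
qed

lemma verts_down_left_graph:
  assumes dl: "down_left_vectors m n a b"
  shows "verts (down_left_graph m n a b) = {(i, j). 1 \<le> i \<and> i \<le> m \<and> a i < j \<and> j < b i}"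
proof -
  have bn: "b i \<le> n + 1" if "1 \<le> i" "i \<le> m" for i
  proof -
    have "b i \<le> b m"
      using dl that by (intro mono_onD[of "{1..m}" b]) (auto simp: down_left_vectors_def)
    then show ?thesis using dl by (simp add: down_left_vectors_def)
  qed
  have "(i, j) \<in> verts (down_left_graph m n a b) \<longleftrightarrow> 1 \<le> i \<and> i \<le> m \<and> a i < j \<and> j < b i" for i j
  proof (cases "1 \<le> i \<and> i \<le> m")
    case True
    have a1: "a (Suc 0) = 0" and bm: "b m = n + 1"
      using dl by (auto simp: down_left_vectors_def)
    have W: "(i, j) \<in> del_W m a \<longleftrightarrow> 1 \<le> j \<and> j \<le> a i"
      using True a1 by (cases "i = 1") (auto simp: del_W_def)
    have Z: "(i, j) \<in> del_Z m n b \<longleftrightarrow> b i \<le> j \<and> j \<le> n"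
      using True bm by (cases "i = m") (auto simp: del_Z_def)
    have "(i, j) \<in> verts (down_left_graph m n a b) \<longleftrightarrow>
        1 \<le> j \<and> j \<le> n \<and> \<not> (1 \<le> j \<and> j \<le> a i) \<and> \<not> (b i \<le> j \<and> j \<le> n)"
      using True W Z by (auto simp: down_left_graph_def induced_def grid_graph_def Let_def)
    then show ?thesis using True bn[of i] by linarith
  next
    case False
    then show ?thesis
      by (auto simp: down_left_graph_def induced_def grid_graph_def Let_def)
  qed
  then show ?thesis by auto
qed

end

theory Submission
  imports Defs
begin

text \<open>
  Call a cell \<open>v\<close> down-left of \<open>u\<close> if it lies in a later row and an earlier column; the edges
  join exactly the pairs of cells one of which is down-left of the other.  This relation is
  transitive, and a 5-cycle has no transitive orientation: by transitivity every vertex of an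
  induced 5-cycle would be a source or a sink, and the two kinds would alternate around an odd
  cycle.  Hence the graph is \<open>C\<^sub>5\<close>-free (\<open>C5_free_if_transitive_orientation\<close>).

  For the other two properties, consider all regions \<open>{(i, j). r \<le> i \<le> m, a i < j < b i}\<close> with
  \<open>a\<close> and \<open>b\<close> monotone, in which some rows may be empty.  Let \<open>x = (r, c)\<close> be the last
  cell of the first nonempty row.  Removing \<open>x\<close> lowers \<open>b r\<close> by one, and removing
  \<open>N[x]\<close> moreover cuts the later rows off to the left of column \<open>c\<close>; both results are regions of
  the same kind, so \<open>x\<close> can serve as a shedding vertex and induction on the number of cells gives
  vertex decomposability, provided that all regions are well-covered.

  Well-coveredness follows from the same induction.  The maximal independent sets that avoid \<open>x\<close>
  are maximal in \<open>G \<setminus> x\<close>, those that contain \<open>x\<close> arise from maximal independent sets \<open>J\<close> of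
  \<open>G \<setminus> N[x]\<close>, and within each family the sizes agree by induction.  The two families are linked by
  an exchange: unless \<open>x\<close> is isolated, the cell \<open>y = (r + 1, c - 1)\<close> diagonally below and to
  the left of \<open>x\<close> belongs to the region, and \<open>J \<union> {y}\<close> is maximal independent in \<open>G \<setminus> x\<close> and as large as \<open>J \<union> {x}\<close>.
\<close>

section \<open>Well-covered graphs in terms of maximal independent sets\<close>

definition maximal_independent :: "'a ugraph \<Rightarrow> 'a set \<Rightarrow> bool" where
  "maximal_independent G I \<longleftrightarrow> I \<subseteq> verts G \<and> (\<forall>u\<in>I. \<forall>v\<in>I. {u, v} \<notin> edges G) \<and>
     (\<forall>v\<in>verts G - I. \<exists>u\<in>I. {u, v} \<in> edges G)"

lemma finite_simple_edgeE:
  assumes "finite_simple G" and "e \<in> edges G"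
  obtains u v where "e = {u, v}" "u \<noteq> v" "u \<in> verts G" "v \<in> verts G"
proof -
  have "e \<subseteq> verts G" "card e = 2"
    using assms by (auto simp: finite_simple_def)
  then show thesis
    using that by (auto simp: card_2_iff)
qed

lemma maximal_independent_Diff_minimal_vertex_cover:
  assumes "finite_simple G" and "minimal_vertex_cover G C"
  shows "maximal_independent G (verts G - C)"
proof -
  have C: "C \<subseteq> verts G" and cov: "\<And>e. e \<in> edges G \<Longrightarrow> e \<inter> C \<noteq> {}"
    and min: "\<And>D. D \<subset> C \<Longrightarrow> \<not> vertex_cover G D"
    using assms by (auto simp: minimal_vertex_cover_def vertex_cover_def)
  have "\<exists>u\<in>verts G - C. {u, v} \<in> edges G" if v: "v \<in> C" for v
  proof -
    have "\<not> vertex_cover G (C - {v})"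
      using min[of "C - {v}"] v by blast
    then obtain e where e: "e \<in> edges G" "e \<inter> (C - {v}) = {}"
      using C by (auto simp: vertex_cover_def)
    have "v \<in> e"
      using cov[OF e(1)] e(2) by blast
    from assms(1) e(1) obtain p q where "e = {p, q}" "p \<noteq> q" "p \<in> verts G" "q \<in> verts G"
      by (rule finite_simple_edgeE)
    with \<open>v \<in> e\<close> obtain u where "e = {u, v}" "u \<noteq> v" "u \<in> verts G"
      by (auto simp: insert_commute)
    then show ?thesis
      using e by blast
  qed
  then show ?thesis
    using cov by (fastforce simp: maximal_independent_def)
qed

lemma minimal_vertex_cover_Diff_maximal_independent:
  assumes "finite_simple G" and "maximal_independent G I"
  shows "minimal_vertex_cover G (verts G - I)"
proof -
  have I: "I \<subseteq> verts G" and ind: "\<And>u v. u \<in> I \<Longrightarrow> v \<in> I \<Longrightarrow> {u, v} \<notin> edges G"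
    and max: "\<And>v. v \<in> verts G - I \<Longrightarrow> \<exists>u\<in>I. {u, v} \<in> edges G"
    using assms by (auto simp: maximal_independent_def)
  have "e \<inter> (verts G - I) \<noteq> {}" if e: "e \<in> edges G" for e
    using assms(1) e by (rule finite_simple_edgeE) (use ind e in blast)
  moreover have "\<not> vertex_cover G D" if D: "D \<subset> verts G - I" for D
  proof -
    obtain v where v: "v \<in> verts G - I" "v \<notin> D"
      using D by blast
    then obtain u where "u \<in> I" "{u, v} \<in> edges G"
      using max by blast
    moreover from this have "{u, v} \<inter> D = {}"
      using v D by blast
    ultimately show ?thesis
      unfolding vertex_cover_def by blast
  qed
  ultimately show ?thesis
    by (auto simp: minimal_vertex_cover_def vertex_cover_def)
qed

lemma well_covered_iff_maximal_independent:
  assumes "finite_simple G"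
  shows "well_covered G \<longleftrightarrow>
    (\<forall>I J. maximal_independent G I \<longrightarrow> maximal_independent G J \<longrightarrow> card I = card J)"
    (is "_ \<longleftrightarrow> ?eq")
proof
  have fin: "finite (verts G)"
    using assms by (simp add: finite_simple_def)
  show "well_covered G" if ?eq
    unfolding well_covered_def
  proof (intro allI impI)
    fix C D assume CD: "minimal_vertex_cover G C \<and> minimal_vertex_cover G D"
    then have "card (verts G - C) = card (verts G - D)"
      using that maximal_independent_Diff_minimal_vertex_cover[OF assms] by blast
    moreover have "C \<subseteq> verts G" "D \<subseteq> verts G"
      using CD by (auto simp: minimal_vertex_cover_def vertex_cover_def)
    ultimately show "card C = card D"
      using fin by (metis card_Diff_subset card_mono diff_diff_cancel finite_subset)
  qed
  show ?eq if wc: "well_covered G"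
  proof (intro allI impI)
    fix I J assume IJ: "maximal_independent G I" "maximal_independent G J"
    then have "card (verts G - I) = card (verts G - J)"
      using wc minimal_vertex_cover_Diff_maximal_independent[OF assms]
      unfolding well_covered_def by blast
    moreover have "I \<subseteq> verts G" "J \<subseteq> verts G"
      using IJ by (auto simp: maximal_independent_def)
    ultimately show "card I = card J"
      using fin by (metis card_Diff_subset card_mono diff_diff_cancel finite_subset)
  qed
qed

lemma finite_simple_del_verts: "finite_simple G \<Longrightarrow> finite_simple (del_verts G T)"
  by (auto simp: finite_simple_def del_verts_def induced_def)

lemma maximal_independent_del_vertex:
  assumes "maximal_independent G I" and "x \<notin> I"
  shows "maximal_independent (del_verts G {x}) I"
  using assms by (fastforce simp: maximal_independent_def del_verts_def induced_def)

lemma maximal_independent_del_closed_nbhd: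
  assumes "finite_simple G" and "maximal_independent G I" and "x \<in> I"
  shows "maximal_independent (del_verts G (closed_nbhd G x)) (I - {x})"
proof -
  have I: "I \<subseteq> verts G" and ind: "\<And>u v. u \<in> I \<Longrightarrow> v \<in> I \<Longrightarrow> {u, v} \<notin> edges G"
    and max: "\<And>v. v \<in> verts G \<Longrightarrow> v \<notin> I \<Longrightarrow> \<exists>u\<in>I. {u, v} \<in> edges G"
    using assms by (auto simp: maximal_independent_def)
  have sub: "I - {x} \<subseteq> verts G - closed_nbhd G x"
    using I ind assms(3) by (auto simp: closed_nbhd_def)
  have "\<exists>u\<in>I - {x}. {u, v} \<in> edges G"
    if v: "v \<in> verts G - closed_nbhd G x" "v \<notin> I - {x}" for v
  proof -
    have "v \<notin> I" "{x, v} \<notin> edges G"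
      using v by (auto simp: closed_nbhd_def)
    with max[of v] v show ?thesis
      by blast
  qed
  with sub ind show ?thesis
    by (fastforce simp: maximal_independent_def del_verts_def induced_def)
qed

text \<open>
  The maximal independent sets through \<open>x\<close> all have one size and those avoiding \<open>x\<close> all have one
  size.  The last hypothesis makes the two sizes equal: swapping \<open>x\<close> for a suitable \<open>y\<close> turns a set
  of the first kind into a maximal independent set of \<open>G \<setminus> x\<close>.  If \<open>x\<close> is isolated, no
  set avoids it.
\<close>

lemma well_covered_if_exchange:
  assumes fs: "finite_simple G" and x: "x \<in> verts G"
    and wc_del: "well_covered (del_verts G {x})"
    and wc_link: "well_covered (del_verts G (closed_nbhd G x))"
    and exch: "(\<forall>v. {x, v} \<notin> edges G) \<or>
      (\<forall>J. maximal_independent (del_verts G (closed_nbhd G x)) J \<longrightarrow>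
        (\<exists>y. y \<notin> J \<and> maximal_independent (del_verts G {x}) (insert y J)))"
  shows "well_covered G"
proof -
  have fin: "finite I" if "maximal_independent G I" for I
    using that fs by (auto simp: maximal_independent_def finite_simple_def intro: finite_subset)
  have del: "card I = card J"
    if "maximal_independent (del_verts G {x}) I" "maximal_independent (del_verts G {x}) J" for I J
    using that wc_del well_covered_iff_maximal_independent[OF finite_simple_del_verts[OF fs]] by blast
  have link: "card I = card J"
    if "maximal_independent (del_verts G (closed_nbhd G x)) I"
      "maximal_independent (del_verts G (closed_nbhd G x)) J" for I J
    using that wc_link well_covered_iff_maximal_independent[OF finite_simple_del_verts[OF fs]] by blast
  have both: "card I = card I'" if "maximal_independent G I" "maximal_independent G I'"
      "x \<in> I" "x \<in> I'" for I I'
    using link[OF maximal_independent_del_closed_nbhd[OF fs that(1,3)]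
        maximal_independent_del_closed_nbhd[OF fs that(2,4)]] that fin
    by (metis card_Suc_Diff1)
  have mixed: "card I = card I'" if I: "maximal_independent G I" "x \<in> I"
    and I': "maximal_independent G I'" "x \<notin> I'" for I I'
  proof -
    have "\<exists>v. {x, v} \<in> edges G"
      using I' x unfolding maximal_independent_def by (metis DiffI insert_commute)
    then obtain y where y: "y \<notin> I - {x}" "maximal_independent (del_verts G {x}) (insert y (I - {x}))"
      using exch maximal_independent_del_closed_nbhd[OF fs I] by blast
    have "card I' = card (insert y (I - {x}))"
      using del[OF maximal_independent_del_vertex[OF I'] y(2)] .
    also have "\<dots> = card I"
      using y(1) I fin[OF I(1)] by (metis card_Suc_Diff1 card_insert_disjoint finite_Diff)
    finally show ?thesis ..
  qed
  have none: "card I = card I'" if "maximal_independent G I" "maximal_independent G I'"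
      "x \<notin> I" "x \<notin> I'" for I I'
    using del maximal_independent_del_vertex that by metis
  show ?thesis
    unfolding well_covered_iff_maximal_independent[OF fs] using both mixed none by metis
qed

section \<open>Induced 5-cycles and transitive orientations\<close>

lemma C5_free_if_transitive_orientation:
  assumes trans: "\<And>u v w. R u v \<Longrightarrow> R v w \<Longrightarrow> R u w"
    and adj: "\<And>u v. u \<in> verts G \<Longrightarrow> v \<in> verts G \<Longrightarrow> {u, v} \<in> edges G \<longleftrightarrow> R u v \<or> R v u"
  shows "C5_free G"
  unfolding C5_free_def
proof
  assume "\<exists>S\<subseteq>verts G. isomorphic (induced G S) cycle5"
  then obtain S f where S: "S \<subseteq> verts G" and bij: "bij_betw f S {0..<5::nat}"
    and iso: "\<And>u v. u \<in> S \<Longrightarrow> v \<in> S \<Longrightarrow> {u, v} \<in> edges G \<longleftrightarrow> {f u, f v} \<in> edges cycle5"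
    by (fastforce simp: isomorphic_def induced_def cycle5_def Int_absorb1)
  define g where "g = inv_into S f"
  have g: "g k \<in> S" "f (g k) = k" if "k < 5" for k
    using bij that by (auto simp: g_def bij_betw_def inv_into_into f_inv_into_f)
  have edge: "(R (g k) (g l) \<or> R (g l) (g k)) \<longleftrightarrow> {k, l} \<in> edges cycle5" if "k < 5" "l < 5" for k l
    using iso[of "g k" "g l"] adj[of "g k" "g l"] g that S by auto
  have C: "{k, l} \<in> edges cycle5 \<longleftrightarrow> (\<exists>i<5. {k, l} = {i, (i + 1) mod 5})" for k l
    by (auto simp: cycle5_def)
  have E: "R (g 0) (g 1) \<or> R (g 1) (g 0)" "R (g 1) (g 2) \<or> R (g 2) (g 1)"
    "R (g 2) (g 3) \<or> R (g 3) (g 2)" "R (g 3) (g 4) \<or> R (g 4) (g 3)"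
    "R (g 4) (g 0) \<or> R (g 0) (g 4)"
    by (subst edge; force simp: C)+
  have N: "\<not> (R (g 0) (g 2) \<or> R (g 2) (g 0))" "\<not> (R (g 1) (g 3) \<or> R (g 3) (g 1))"
    "\<not> (R (g 2) (g 4) \<or> R (g 4) (g 2))" "\<not> (R (g 3) (g 0) \<or> R (g 0) (g 3))"
    "\<not> (R (g 4) (g 1) \<or> R (g 1) (g 4))"
    by (subst edge; auto simp: C doubleton_eq_iff)+
  \<comment> \<open>Each vertex of an induced path \<open>u v w\<close> is a source or a sink, so the orientation flips at \<open>v\<close>.\<close>
  have alternate: "R u v \<longleftrightarrow> \<not> R v u" "R v u \<longleftrightarrow> R v w"
    if "R u v \<or> R v u" "R v w \<or> R w v" "\<not> (R u w \<or> R w u)" for u v w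
    using that trans by blast+
  show False
    using alternate[OF E(1) E(2) N(1)] alternate[OF E(2) E(3) N(2)] alternate[OF E(3) E(4) N(3)]
      alternate[OF E(4) E(5) N(4)] alternate[OF E(5) E(1) N(5)]
    by blast
qed

section \<open>Monotone regions of the grid\<close>

definition down_left :: "nat \<times> nat \<Rightarrow> nat \<times> nat \<Rightarrow> bool" where
  "down_left u v \<longleftrightarrow> fst u < fst v \<and> snd v < snd u"

definition cell_graph :: "(nat \<times> nat) set \<Rightarrow> (nat \<times> nat) ugraph" where
  "cell_graph S = UGraph S {{u, v} | u v. u \<in> S \<and> v \<in> S \<and> down_left u v}"

lemma verts_cell_graph [simp]: "verts (cell_graph S) = S"
  by (simp add: cell_graph_def)

lemma edge_cell_graph_iff:
  "{u, v} \<in> edges (cell_graph S) \<longleftrightarrow> u \<in> S \<and> v \<in> S \<and> (down_left u v \<or> down_left v u)"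
  unfolding cell_graph_def ugraph.sel mem_Collect_eq doubleton_eq_iff by blast

lemma finite_simple_cell_graph: "finite S \<Longrightarrow> finite_simple (cell_graph S)"
  by (auto simp: finite_simple_def cell_graph_def down_left_def card_2_iff)

lemma del_verts_cell_graph: "del_verts (cell_graph S) T = cell_graph (S - T)"
proof -
  have "{e \<in> edges (cell_graph S). e \<subseteq> S - T} = edges (cell_graph (S - T))"
    unfolding cell_graph_def ugraph.sel by blast
  then show ?thesis
    by (simp add: del_verts_def induced_def cell_graph_def Int_absorb1)
qed

text \<open>
  Shedding empties the rows from the first one on, so the row range starts at an arbitrary \<open>r\<close>.
\<close>

definition region :: "nat \<Rightarrow> nat \<Rightarrow> (nat \<Rightarrow> nat) \<Rightarrow> (nat \<Rightarrow> nat) \<Rightarrow> (nat \<times> nat) set" where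
  "region r m a b = {(i, j). r \<le> i \<and> i \<le> m \<and> a i < j \<and> j < b i}"

text \<open>
  Monotonicity is what survives the deletions used for shedding, which change the bounds of the
  first row and of all later ones and may leave rows empty.
\<close>

definition monotone_bounds :: "nat \<Rightarrow> nat \<Rightarrow> (nat \<Rightarrow> nat) \<Rightarrow> (nat \<Rightarrow> nat) \<Rightarrow> bool" where
  "monotone_bounds r m a b \<longleftrightarrow> mono_on {r..m} a \<and> mono_on {r..m} b"

lemma monotone_boundsD:
  assumes "monotone_bounds r m a b" and "r \<le> i" and "i \<le> k" and "k \<le> m"
  shows "a i \<le> a k" "b i \<le> b k"
  using assms by (auto simp: monotone_bounds_def intro: mono_onD)

lemma finite_region: "finite (region r m a b)"
proof -
  have "region r m a b = Sigma {r..m} (\<lambda>i. {a i<..<b i})"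
    by (auto simp: region_def)
  then show ?thesis
    by simp
qed

lemma region_starting_at_nonempty_row:
  assumes "monotone_bounds r m a b" and "region r m a b \<noteq> {}"
  obtains r' where "monotone_bounds r' m a b" "region r' m a b = region r m a b"
    "r' \<le> m" "a r' + 1 < b r'"
proof -
  let ?P = "\<lambda>i. r \<le> i \<and> i \<le> m \<and> a i + 1 < b i"
  define r' where "r' = (LEAST i. ?P i)"
  have "\<exists>i. ?P i"
    using assms(2) by (fastforce simp: region_def)
  then have r': "?P r'"
    unfolding r'_def by (rule LeastI_ex)
  have least: "r' \<le> i" if "?P i" for i
    unfolding r'_def using that by (rule Least_le)
  have "region r' m a b = region r m a b"
    using least r' by (fastforce simp: region_def)
  moreover have "monotone_bounds r' m a b"
    using assms(1) r' by (auto simp: monotone_bounds_def intro: mono_on_subset)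
  ultimately show thesis
    using that r' by blast
qed

text \<open>
  The corner \<open>x = (r, c)\<close> is the last cell of the first row.  The cells \<open>(r, c - 1)\<close>, \<open>(r + 1, c)\<close>
  and \<open>y = (r + 1, c - 1)\<close> complete it to a square.  The first two belong to \<open>J\<close> as soon as they lie
  in the region, because neither is adjacent to any cell outside \<open>N[x]\<close>.  This makes \<open>J \<union> {y}\<close>
  maximal: a neighbour of \<open>x\<close> other than \<open>y\<close> is adjacent to \<open>(r, c - 1)\<close> if it lies in row \<open>r + 1\<close>,
  and to \<open>(r + 1, c)\<close> if it lies in a later row.
\<close>

lemma corner_exchange:
  assumes mb: "monotone_bounds r m a b" and r: "r \<le> m" and ne: "a r + 1 < b r"
  defines "S \<equiv> region r m a b" and "x \<equiv> (r, b r - 1)" and "y \<equiv> (r + 1, b r - 2)"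
  assumes nbr: "v0 \<in> S" "down_left x v0"
    and J: "maximal_independent (cell_graph (S - closed_nbhd (cell_graph S) x)) J"
  shows "y \<notin> J \<and> maximal_independent (cell_graph (S - {x})) (insert y J)"
proof -
  note a = monotone_boundsD(1)[OF mb] and b = monotone_boundsD(2)[OF mb]
  obtain c where c: "b r = Suc c" "a r < c"
    using ne by (cases "b r") auto
  have x: "x = (r, c)" and y: "y = (Suc r, c - 1)"
    using c by (auto simp: x_def y_def)
  have xS: "x \<in> S"
    using c r by (auto simp: x S_def region_def)
  define L where "L = {v \<in> S. v \<noteq> x \<and> \<not> down_left x v}"
  have L: "S - closed_nbhd (cell_graph S) x = L"
    using xS by (auto simp: L_def closed_nbhd_def edge_cell_graph_iff)
       (auto simp: down_left_def x S_def region_def)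
  have JL: "J \<subseteq> L"
    and ind: "\<And>u v. u \<in> J \<Longrightarrow> v \<in> J \<Longrightarrow> \<not> down_left u v"
    and max: "\<And>v. v \<in> L \<Longrightarrow> v \<notin> J \<Longrightarrow> \<exists>u\<in>J. down_left u v \<or> down_left v u"
    using J unfolding L by (auto simp: maximal_independent_def edge_cell_graph_iff; blast)+
  have L_cases: "(i = r \<and> j < c) \<or> (r < i \<and> c \<le> j)" if "(i, j) \<in> L" for i j
    using that c by (auto simp: L_def S_def region_def x down_left_def)
  obtain i0 j0 where v0: "v0 = (i0, j0)" "r < i0" "i0 \<le> m" "a i0 < j0" "j0 < c"
    using nbr by (cases v0) (auto simp: S_def region_def x down_left_def)
  \<comment> \<open>Any neighbour of \<open>x\<close> forces row \<open>r + 1\<close> to start before column \<open>c - 1\<close> as \<open>a\<close> is monotone.\<close>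
  have r1: "Suc r \<le> m" "a (Suc r) < c - 1" "Suc c \<le> b (Suc r)"
    using a[of "Suc r" i0] b[of r "Suc r"] v0 c by auto
  have yS: "y \<in> S - {x}" and y_nbr: "down_left x y"
    using r1 by (auto simp: S_def region_def y x down_left_def)
  have "(Suc r, c) \<in> L"
    using r1 by (auto simp: L_def S_def region_def x down_left_def)
  then have below: "(Suc r, c) \<in> J"
    using max[of "(Suc r, c)"] JL L_cases by (fastforce simp: down_left_def)
  have left: "(r, c - 1) \<in> J" if "a r < c - 1"
  proof -
    have "(r, c - 1) \<in> L"
      using that r c by (auto simp: L_def S_def region_def x down_left_def)
    then show ?thesis
      using max[of "(r, c - 1)"] JL L_cases by (fastforce simp: down_left_def)
  qed
  have ind_y: "\<not> down_left y v \<and> \<not> down_left v y" if "v \<in> J" for v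
    using that JL L_cases by (cases v) (force simp: down_left_def y)
  have max_y: "\<exists>u\<in>insert y J. down_left u v \<or> down_left v u"
    if v: "v \<in> S" "v \<noteq> x" "v \<notin> insert y J" for v
  proof (cases "v \<in> L")
    case True
    then show ?thesis
      using max v by blast
  next
    case False
    then obtain i j where ij: "v = (i, j)" "r < i" "i \<le> m" "a i < j" "j < c"
      using v by (cases v) (auto simp: L_def S_def region_def x down_left_def)
    show ?thesis
    proof (cases "i = Suc r")
      case False
      then have "down_left (Suc r, c) v"
        using ij by (simp add: down_left_def)
      then show ?thesis
        using below by blast
    next
      case True
      then have "j < c - 1"
        using ij v by (auto simp: y)
      moreover have "a r < j"
        using a[of r i] ij by simp
      ultimately show ?thesis
        using left True ij by (intro bexI[of _ "(r, c - 1)"]) (auto simp: down_left_def)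
    qed
  qed
  have "y \<notin> J"
    using y_nbr JL by (auto simp: L_def)
  moreover have "J \<subseteq> S - {x}"
    using JL by (auto simp: L_def)
  moreover have "\<not> down_left y y"
    by (simp add: down_left_def)
  ultimately show ?thesis
    using yS ind ind_y max_y
    by (auto simp: maximal_independent_def edge_cell_graph_iff subset_iff; blast)
qed

lemma region_minus_corner:
  assumes mb: "monotone_bounds r m a b" and r: "r \<le> m" and ne: "a r + 1 < b r"
  defines "b' \<equiv> b(r := b r - 1)"
  shows "monotone_bounds r m a b'" "region r m a b - {(r, b r - 1)} = region r m a b'"
proof -
  have "mono_on {r..m} b'"
  proof (rule mono_onI)
    fix i k assume "i \<in> {r..m}" "k \<in> {r..m}" "i \<le> k"
    then show "b' i \<le> b' k"
      using monotone_boundsD(2)[OF mb, of i k] by (auto simp: b'_def)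
  qed
  then show "monotone_bounds r m a b'"
    using mb by (simp add: monotone_bounds_def)
  show "region r m a b - {(r, b r - 1)} = region r m a b'"
    using r ne by (auto simp: region_def b'_def split: if_splits)
qed

text \<open>
  The non-neighbours of the corner \<open>(r, c)\<close> in later rows are the cells from column \<open>c\<close> on, which is
  the strict lower bound \<open>c - 1 = b r - 2\<close>.
\<close>

lemma region_minus_closed_nbhd_corner:
  assumes mb: "monotone_bounds r m a b" and r: "r \<le> m" and ne: "a r + 1 < b r"
  defines "S \<equiv> region r m a b"
    and "a' \<equiv> \<lambda>i. if i = r then a r else max (a i) (b r - 2)"
    and "b' \<equiv> b(r := b r - 1)"
  shows "monotone_bounds r m a' b'"
    "S - closed_nbhd (cell_graph S) (r, b r - 1) = region r m a' b'"
proof -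
  note a = monotone_boundsD(1)[OF mb] and b = monotone_boundsD(2)[OF mb]
  obtain c where c: "b r = Suc c" "a r < c"
    using ne by (cases "b r") auto
  have "mono_on {r..m} a'"
  proof (rule mono_onI)
    fix i k assume "i \<in> {r..m}" "k \<in> {r..m}" "i \<le> k"
    then show "a' i \<le> a' k"
      using a[of i k] by (auto simp: a'_def)
  qed
  moreover have "mono_on {r..m} b'"
  proof (rule mono_onI)
    fix i k assume "i \<in> {r..m}" "k \<in> {r..m}" "i \<le> k"
    then show "b' i \<le> b' k"
      using b[of i k] by (auto simp: b'_def)
  qed
  ultimately show "monotone_bounds r m a' b'"
    by (simp add: monotone_bounds_def)
  have "(i, j) \<in> S - closed_nbhd (cell_graph S) (r, b r - 1) \<longleftrightarrow> (i, j) \<in> region r m a' b'" for i j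
    using r c
    by (cases "i = r") (auto simp: S_def closed_nbhd_def edge_cell_graph_iff region_def down_left_def
        a'_def b'_def)
  then show "S - closed_nbhd (cell_graph S) (r, b r - 1) = region r m a' b'"
    by auto
qed

lemma well_covered_vertex_decomposable_region:
  assumes "monotone_bounds r m a b"
  shows "well_covered (cell_graph (region r m a b)) \<and>
    vertex_decomposable (cell_graph (region r m a b))"
  using assms
proof (induction "card (region r m a b)" arbitrary: r a b rule: less_induct)
  case less
  show ?case
  proof (cases "region r m a b = {}")
    case True
    have "well_covered (cell_graph ({} :: (nat \<times> nat) set))"
      by (auto simp: well_covered_iff_maximal_independent[OF finite_simple_cell_graph]
          maximal_independent_def)
    moreover have "edges (cell_graph {}) = {}"
      by (simp add: cell_graph_def)
    ultimately show ?thesis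
      unfolding True by (auto intro: vertex_decomposable.isolated)
  next
    case False
    obtain r' where mb: "monotone_bounds r' m a b" and eq: "region r' m a b = region r m a b"
      and r': "r' \<le> m" "a r' + 1 < b r'"
      using region_starting_at_nonempty_row[OF less.prems False] by blast
    define S where "S = region r m a b"
    define x where "x = (r', b r' - 1)"
    let ?G = "cell_graph S"
    have S: "S = region r' m a b"
      by (simp add: S_def eq)
    have fin: "finite S"
      by (simp add: S_def finite_region)
    have x: "x \<in> S"
      using r' by (auto simp: S x_def region_def)
    have IH: "well_covered (cell_graph T) \<and> vertex_decomposable (cell_graph T)"
      if "T \<subset> S" "T = region r' m a' b'" "monotone_bounds r' m a' b'" for T a' b'
      using less.hyps[of r' a' b'] that psubset_card_mono[OF fin that(1)] by (simp add: S_def)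
    have "S - {x} \<subset> S" "S - closed_nbhd ?G x \<subset> S"
      using x by (auto simp: closed_nbhd_def)
    then have del: "well_covered (del_verts ?G {x}) \<and> vertex_decomposable (del_verts ?G {x})"
      and link: "well_covered (del_verts ?G (closed_nbhd ?G x)) \<and>
        vertex_decomposable (del_verts ?G (closed_nbhd ?G x))"
      using IH region_minus_corner[OF mb r'] region_minus_closed_nbhd_corner[OF mb r']
      unfolding del_verts_cell_graph S x_def by blast+
    have "(\<forall>v. {x, v} \<notin> edges ?G) \<or>
      (\<forall>J. maximal_independent (del_verts ?G (closed_nbhd ?G x)) J \<longrightarrow>
        (\<exists>y. y \<notin> J \<and> maximal_independent (del_verts ?G {x}) (insert y J)))"
    proof (cases "\<exists>v\<in>S. down_left x v")
      case True
      then show ?thesis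
        using corner_exchange[OF mb r'] unfolding del_verts_cell_graph S x_def by blast
    next
      case False
      moreover have "\<not> down_left v x" if "v \<in> S" for v
        using that by (auto simp: S region_def x_def down_left_def)
      ultimately show ?thesis
        by (auto simp: edge_cell_graph_iff)
    qed
    then have "well_covered ?G"
      using well_covered_if_exchange[OF finite_simple_cell_graph[OF fin]] x del link by auto
    then show ?thesis
      using vertex_decomposable.shedding[of ?G x] x del link by (auto simp: S_def)
  qed
qed

section \<open>Down-left graphs\<close>

lemma down_left_graph_eq_cell_graph:
  assumes "down_left_vectors m n a b"
  shows "down_left_graph m n a b = cell_graph (region 1 m a b)"
proof (rule ugraph.expand, intro conjI)
  let ?D = "down_left_graph m n a b"
  show V: "verts ?D = verts (cell_graph (region 1 m a b))"
    using verts_down_left_graph[OF assms] by (simp add: region_def)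
  have "edges ?D = {{u, v} | u v. u \<in> verts ?D \<and> v \<in> verts ?D \<and> down_left u v}"
    by (fastforce simp: down_left_graph_def induced_def grid_graph_def Let_def down_left_def)
  then show "edges ?D = edges (cell_graph (region 1 m a b))"
    unfolding V by (simp add: cell_graph_def)
qed

lemma monotone_bounds_down_left_vectors:
  assumes "down_left_vectors m n a b"
  shows "monotone_bounds 1 m a b"
  using assms by (simp add: monotone_bounds_def down_left_vectors_def)

theorem theorem1p1:
  fixes m n :: nat and a b :: "nat \<Rightarrow> nat"
  assumes "1 \<le> m" and "1 \<le> n"
    and "down_left_vectors m n a b"
  shows "well_covered (down_left_graph m n a b)
       \<and> C5_free (down_left_graph m n a b)
       \<and> vertex_decomposable (down_left_graph m n a b)"
proof -
  have "C5_free (cell_graph (region 1 m a b))"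
    by (rule C5_free_if_transitive_orientation[where R = down_left])
       (auto simp: down_left_def edge_cell_graph_iff)
  then show ?thesis
    using well_covered_vertex_decomposable_region[OF monotone_bounds_down_left_vectors[OF assms(3)]]
    unfolding down_left_graph_eq_cell_graph[OF assms(3)] by blast
qed

end
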